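(* Write $K=K_1+K_2\mathbf i+K_3\mathbf j+K_4\mathbf k$ with real-valued $K_1,\dots,K_4$. There exists a positive integer $\mathfrak a_0$ such that: (1) for any $j\in\mathbb Z$ and $T\in\mathfrak T_j$, there is a unique $T_{\mathfrak a_0}\in\mathfrak T_{j+\mathfrak a_0}$ such that $T\subset T_{\mathfrak a_0}$; (2) there exist constants $3\le\mathfrak a_1\le\mathfrak a_2$ and $C>0$ such that for any $j\in\mathbb Z$ and any tile $T\in\mathfrak T_j$ there exists a tile $\hat T\in\mathfrak T_j$ satisfying: (a) $\hat T\subset T_{\mathfrak a_0}$; (b) $\mathfrak a_12^j\le d(\operatorname{cent}(T),\operatorname{cent}(\hat T))\le\mathfrak a_22^j$; (c) there exists $i\in\{1,2,3,4\}$ such that for all $(g,\hat g)\in T\times\hat T$ one has $|K_i(g,\hat g)|\ge C2^{-(4n+2)j}$, and $K_i(g,\hat g)$ does not change sign on $T\times\hat T$.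
   Context: Let $n\ge2$. $\mathbb H$ denotes the quaternions. The quaternionic Heisenberg group $\mathscr H^{n-1}$ is $\mathbb R^{4n-1}=\mathbb R^3\times\mathbb R^{4n-4}$ with the product $(\bm t,\bm y)\cdot(\bm t',\bm y')=(\bm t+\bm t'+B(\bm y,\bm y'),\bm y+\bm y')$, $B=(B_1,B_2,B_3)$, $B_\alpha(\bm y,\bm y')=2\sum_{l=0}^{n-2}\sum_{j,k=1}^4 b^\alpha_{kj}y_{4l+k}y'_{4l+j}$, where $b^1=\begin{pmatrix}0&1&0&0\\-1&0&0&0\\0&0&0&-1\\0&0&1&0\end{pmatrix}$, $b^2=\begin{pmatrix}0&0&1&0\\0&0&0&1\\-1&0&0&0\\0&-1&0&0\end{pmatrix}$, $b^3=\begin{pmatrix}0&0&0&1\\0&0&-1&0\\0&1&0&0\\-1&0&0&0\end{pmatrix}$. The homogeneous norm is $\|(\bm t,\bm y)\|=(|\bm y|^4+|\bm t|^2)^{1/4}$, $d(g,g')=\|g'^{-1}\cdot g\|$, dilations $\delta_r(\bm t,\bm y)=(r^2\bm t,r\bm y)$, left translations $\tau_h(g)=h\cdot g$. Tiles. Basic tile: $A=\{(\bm t,\bm y): \bm y\in[0,1)^{4n-4},\ F_j(\bm y)\le t_j<F_j(\bm y)+1,\ j=1,2,3\}$, where $F_j(\bm y)=\sum_{m=1}^\infty4^{-m}B_j\big([2^m\bm y]\bmod 2,\langle2^m\bm y\rangle\big)$, with $[\cdot]$ and $\langle\cdot\rangle$ the componentwise integer and fractional parts. $\mathscr H^{n-1}_{\mathbb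 Z}=\mathbb Z^3\times\mathbb Z^{4n-4}\subset\mathscr H^{n-1}$. $\mathfrak T_0=\{\tau_g(A):g\in\mathscr H^{n-1}_{\mathbb Z}\}$, $\mathfrak T_j=\delta_{2^j}\mathfrak T_0$ for $j\in\mathbb Z$. Let $M=\max\{|B_j(\bm y,\bm y')|:\bm y,\bm y'\in[0,1]^{4n-4},j=1,2,3\}$, fix an integer $n_0>2+[\log_4M]$, and let $g_o\in A$ be the point all of whose $\bm y$-coordinates equal $2^{-n_0-1}$ and all of whose $\bm t$-coordinates equal $\frac12$. For $T=\delta_{2^j}\circ\tau_g(A)$ with $g\in\mathscr H^{n-1}_{\mathbb Z}$, $\operatorname{cent}(T)=\delta_{2^j}\circ\tau_g(g_o)$. Cauchy--Szegő kernel: for $\sigma=x_1+x_2\mathbf i+x_3\mathbf j+x_4\mathbf k\in\mathbb H\setminus\{0\}$, $s(\sigma)=c_{n-1}\dfrac{\partial^{2(n-1)}}{\partial x_1^{2(n-1)}}\dfrac{\overline\sigma}{|\sigma|^4}$, where $c_{n-1}$ is a nonzero real constant depending only on $n$. With $\bm t\in\mathbb R^3$ identified with $t_1\mathbf i+t_2\mathbf j+t_3\mathbf k$, $K(\bm t,\bm y)=s(|\bm y|^2+\bm t)$ for $(\bm t,\bm y)\ne0$ and $K(g,h)=K(h^{-1}\cdot g)$ for $g\ne h$. *)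

theory Defs
  imports "HOL-Analysis.Analysis"
begin

section \<open>The quaternionic Heisenberg group\<close>

text \<open>
  The factor \<open>\<real>\<^bsup>4n-4\<^esup>\<close> is rendered as \<^typ>\<open>real^4^'m\<close> with \<open>CARD('m) = n - 1\<close>: the coordinate
  \<open>y\<^bsub>4l+k\<^esub>\<close> (\<open>0 \<le> l \<le> n - 2\<close>, \<open>1 \<le> k \<le> 4\<close>) is \<open>y $ l $ k\<close>, where \<open>l :: 'm\<close> and \<open>k :: 4\<close>.
  The norm of this type is the Euclidean norm of the \<open>4n - 4\<close> coordinates.
\<close>

type_synonym 'm heis = "(real^3) \<times> (real^4^'m)"

definition bmat :: "real^4^4^3" where
  "bmat = vector [
     vector [vector [ 0, 1, 0, 0],
             vector [-1, 0, 0, 0],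
             vector [ 0, 0, 0,-1],
             vector [ 0, 0, 1, 0]],
     vector [vector [ 0, 0, 1, 0],
             vector [ 0, 0, 0, 1],
             vector [-1, 0, 0, 0],
             vector [ 0,-1, 0, 0]],
     vector [vector [ 0, 0, 0, 1],
             vector [ 0, 0,-1, 0],
             vector [ 0, 1, 0, 0],
             vector [-1, 0, 0, 0]]]"

definition Bform :: "real^4^'m \<Rightarrow> real^4^'m \<Rightarrow> real^3" where
  "Bform y y' = (\<chi> a. 2 * (\<Sum>l\<in>UNIV. \<Sum>j\<in>UNIV. \<Sum>k\<in>UNIV. bmat $ a $ k $ j * y $ l $ k * y' $ l $ j))"

definition hmult :: "'m::finite heis \<Rightarrow> 'm heis \<Rightarrow> 'm heis" where
  "hmult g g' = (fst g + fst g' + Bform (snd g) (snd g'), snd g + snd g')"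

definition hinv :: "'m::finite heis \<Rightarrow> 'm heis" where
  "hinv g = (- fst g, - snd g)"

definition hnorm :: "'m::finite heis \<Rightarrow> real" where
  "hnorm g = root 4 (norm (snd g) ^ 4 + norm (fst g) ^ 2)"

definition hdist :: "'m::finite heis \<Rightarrow> 'm heis \<Rightarrow> real" where
  "hdist g g' = hnorm (hmult (hinv g') g)"

definition dil :: "real \<Rightarrow> 'm::finite heis \<Rightarrow> 'm heis" where
  "dil r g = (r\<^sup>2 *\<^sub>R fst g, r *\<^sub>R snd g)"

definition ltrans :: "'m::finite heis \<Rightarrow> 'm heis \<Rightarrow> 'm heis" where
  "ltrans h g = hmult h g"

lemma vector_4 [simp]:
  "(vector [x, y, z, w] :: 'a::zero^4) $ 1 = x"
  "(vector [x, y, z, w] :: 'a::zero^4) $ 2 = y"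
  "(vector [x, y, z, w] :: 'a::zero^4) $ 3 = z"
  "(vector [x, y, z, w] :: 'a::zero^4) $ 4 = w"
  unfolding vector_def by simp_all

lemma bmat_skew: "bmat $ a $ k $ j = - bmat $ a $ j $ k"
  using exhaust_3[of a] exhaust_4[of k] exhaust_4[of j] by (auto simp: bmat_def)

lemma Bform_self: "Bform y y = 0"
proof -
  have "(\<Sum>j\<in>UNIV. \<Sum>k\<in>UNIV. bmat $ a $ k $ j * y $ l $ k * y $ l $ j) = 0" for a l
    using exhaust_3[of a] by (auto simp: sum_4 bmat_def)
  then show ?thesis by (simp add: Bform_def vec_eq_iff)
qed

lemma Bform_uminus_left: "Bform (- y) y' = - Bform y y'"
  by (simp add: Bform_def vec_eq_iff sum_negf)

lemma Bform_uminus_right: "Bform y (- y') = - Bform y y'"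
  by (simp add: Bform_def vec_eq_iff sum_negf)

lemma hmult_hinv: "hmult (hinv g) g = (0, 0)" "hmult g (hinv g) = (0, 0)"
  by (simp_all add: hmult_def hinv_def Bform_uminus_left Bform_uminus_right Bform_self)


section \<open>Tiles\<close>

definition digits :: "nat \<Rightarrow> real^4^'m \<Rightarrow> real^4^'m" where
  "digits m y = (\<chi> l k. real_of_int (\<lfloor>2 ^ m * y $ l $ k\<rfloor> mod 2))"

definition fracpart :: "nat \<Rightarrow> real^4^'m \<Rightarrow> real^4^'m" where
  "fracpart m y = (\<chi> l k. frac (2 ^ m * y $ l $ k))"

definition Fser :: "real^4^'m \<Rightarrow> real^3" where
  "Fser y = (\<chi> a. \<Sum>i. Bform (digits (Suc i) y) (fracpart (Suc i) y) $ a / 4 ^ Suc i)"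

definition basic_tile :: "'m::finite heis set" where
  "basic_tile = {(t, y). (\<forall>l k. 0 \<le> y $ l $ k \<and> y $ l $ k < 1) \<and>
                         (\<forall>a. Fser y $ a \<le> t $ a \<and> t $ a < Fser y $ a + 1)}"

definition heisZ :: "'m::finite heis set" where
  "heisZ = {(t, y). (\<forall>a. t $ a \<in> \<int>) \<and> (\<forall>l k. y $ l $ k \<in> \<int>)}"

definition tiles0 :: "'m::finite heis set set" where
  "tiles0 = {ltrans g ` basic_tile |g. g \<in> heisZ}"

definition tiles :: "int \<Rightarrow> 'm::finite heis set set" where
  "tiles j = (\<lambda>T. dil (2 powi j) ` T) ` tiles0"

text \<open>A maximum of a continuous function over a compact set, hence written as a supremum.\<close>

definition Bmax :: "'m::finite itself \<Rightarrow> real" where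
  "Bmax _ = Sup {\<bar>Bform y y' $ a\<bar> |(y :: real^4^'m) y' a.
     (\<forall>l k. y $ l $ k \<in> {0..1}) \<and> (\<forall>l k. y' $ l $ k \<in> {0..1})}"

definition base_point :: "int \<Rightarrow> 'm::finite heis" where
  "base_point n0 = ((\<chi> a. 1/2), (\<chi> l k. 2 powi (- n0 - 1)))"

text \<open>
  The description is proper, see \<open>cent_tile\<close> below: a tile determines its generation \<open>j\<close> and the
  lattice point \<open>g\<close>.
\<close>

definition cent :: "int \<Rightarrow> 'm::finite heis set \<Rightarrow> 'm heis" where
  "cent n0 T = (THE p. \<exists>j. \<exists>g\<in>heisZ. T = dil (2 powi j) ` ltrans g ` basic_tile \<and>
                                      p = dil (2 powi j) (ltrans g (base_point n0)))"

lemma snd_tile: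
  fixes g :: "'m::finite heis"
  assumes "r > 0"
  shows "snd ` dil r ` ltrans g ` basic_tile =
    {y. \<forall>l k. r * snd g $ l $ k \<le> y $ l $ k \<and> y $ l $ k < r * snd g $ l $ k + r}" (is "?L = ?R")
proof (intro equalityI subsetI)
  fix y assume "y \<in> ?L"
  then show "y \<in> ?R" using assms
    by (auto simp: dil_def ltrans_def hmult_def basic_tile_def ring_distribs)
next
  fix y assume y: "y \<in> ?R"
  define z where "z = (1 / r) *\<^sub>R y - snd g"
  have "(Fser z, z) \<in> basic_tile"
    using y assms by (auto simp: basic_tile_def z_def field_simps)
  moreover have "snd (dil r (ltrans g (Fser z, z))) = y"
    using assms by (simp add: dil_def ltrans_def hmult_def z_def)
  ultimately show "y \<in> ?L" by (metis imageI)
qed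

lemma box_inj:
  fixes u v :: "real^4^'m"
  assumes "r > 0" "s > 0"
    and eq: "{y. \<forall>l k. u $ l $ k \<le> y $ l $ k \<and> y $ l $ k < u $ l $ k + r} =
             {y. \<forall>l k. v $ l $ k \<le> y $ l $ k \<and> y $ l $ k < v $ l $ k + s}" (is "?U = ?V")
  shows "u = v" "r = s"
proof -
  have "u \<in> ?U" "v \<in> ?V" using assms(1,2) by auto
  then have "u \<in> ?V" "v \<in> ?U" using eq by blast+
  then show uv: "u = v" by (simp add: vec_eq_iff) (metis order.antisym)
  have *: "(\<chi> l k. u $ l $ k + q) \<in> ?U \<longleftrightarrow> 0 \<le> q \<and> q < r"
          "(\<chi> l k. u $ l $ k + q) \<in> ?V \<longleftrightarrow> 0 \<le> q \<and> q < s" for q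
    by (auto simp: uv)
  have "0 \<le> q \<and> q < r \<longleftrightarrow> 0 \<le> q \<and> q < s" for q
    using * eq by blast
  from this[of r] this[of s] show "r = s" using assms by linarith
qed

lemma tile_param_inj:
  fixes g h :: "'m::finite heis"
  assumes "r > 0" "s > 0"
    and eq: "dil r ` ltrans g ` basic_tile = dil s ` ltrans h ` basic_tile"
  shows "r = s" "g = h"
proof -
  have "snd ` dil r ` ltrans g ` basic_tile = snd ` dil s ` ltrans h ` basic_tile"
    using eq by simp
  then have "{y. \<forall>l k. (r *\<^sub>R snd g) $ l $ k \<le> y $ l $ k \<and> y $ l $ k < (r *\<^sub>R snd g) $ l $ k + r} =
      {y. \<forall>l k. (s *\<^sub>R snd h) $ l $ k \<le> y $ l $ k \<and> y $ l $ k < (s *\<^sub>R snd h) $ l $ k + s}"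
    unfolding snd_tile[OF assms(1)] snd_tile[OF assms(2)] by simp
  from box_inj[OF assms(1,2) this]
  show rs: "r = s" and "g = h"
  proof -
    assume y: "r *\<^sub>R snd g = s *\<^sub>R snd h" and rs: "r = s"
    then have sgh: "snd g = snd h" using assms(1) by simp
    have le: "fst b $ a \<le> fst c $ a"
      if sub: "dil r ` ltrans c ` basic_tile \<subseteq> dil r ` ltrans b ` basic_tile"
        and sbc: "snd b = snd c" for b c :: "'m heis" and a
    proof -
      let ?z = "0 :: real^4^'m"
      have B0: "Bform w 0 = 0" for w :: "real^4^'m" by (simp add: Bform_def vec_eq_iff)
      have "(Fser ?z, ?z) \<in> basic_tile" by (simp add: basic_tile_def)
      then have "dil r (ltrans c (Fser ?z, ?z)) \<in> dil r ` ltrans b ` basic_tile"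
        using sub by blast
      then obtain t y where ty: "(t, y) \<in> basic_tile"
        and e: "dil r (ltrans c (Fser ?z, ?z)) = dil r (ltrans b (t, y))" by auto
      from e assms(1) sbc have "y = ?z" by (simp add: dil_def ltrans_def hmult_def)
      with e assms(1) have "fst c + Fser ?z = fst b + t"
        by (simp add: dil_def ltrans_def hmult_def B0)
      then have "fst c $ a + Fser ?z $ a = fst b $ a + t $ a"
        by (metis vector_add_component)
      moreover have "Fser ?z $ a \<le> t $ a" using ty \<open>y = ?z\<close> by (simp add: basic_tile_def)
      ultimately show ?thesis by linarith
    qed
    have "fst g $ a = fst h $ a" for a
      using le[of g h a] le[of h g a] eq sgh by (simp add: rs)
    then show "g = h" using sgh by (simp add: prod_eq_iff vec_eq_iff)
  qed
qed

lemma cent_tile: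
  fixes g :: "'m::finite heis"
  assumes "g \<in> heisZ"
  shows "cent n0 (dil (2 powi j) ` ltrans g ` basic_tile) = dil (2 powi j) (ltrans g (base_point n0))"
  unfolding cent_def
proof (rule the_equality)
  show "\<exists>i. \<exists>h\<in>heisZ. dil (2 powi j) ` ltrans g ` basic_tile = dil (2 powi i) ` ltrans h ` basic_tile \<and>
      dil (2 powi j) (ltrans g (base_point n0)) = dil (2 powi i) (ltrans h (base_point n0))"
    using assms by blast
next
  fix p
  assume "\<exists>i. \<exists>h\<in>heisZ. dil (2 powi j) ` ltrans g ` basic_tile = dil (2 powi i) ` ltrans h ` basic_tile \<and>
      p = dil (2 powi i) (ltrans h (base_point n0))"
  then obtain i h where
    e: "dil (2 powi j) ` ltrans g ` basic_tile = dil (2 powi i) ` ltrans h ` basic_tile"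
    and p: "p = dil (2 powi i) (ltrans h (base_point n0))" by blast
  have "(2::real) powi j > 0" "(2::real) powi i > 0" by simp_all
  from tile_param_inj[OF this e] p
  show "p = dil (2 powi j) (ltrans g (base_point n0))" by simp
qed

text \<open>Only meaningful when exactly one tile of generation \<open>j + a\<close> contains \<open>T\<close>.\<close>

definition ancestor :: "nat \<Rightarrow> int \<Rightarrow> 'm::finite heis set \<Rightarrow> 'm heis set" where
  "ancestor a j T = (THE T'. T' \<in> tiles (j + int a) \<and> T \<subseteq> T')"


section \<open>The Cauchy--Szego kernel\<close>

text \<open>
  A quaternion \<open>x\<^sub>1 + x\<^sub>2 i + x\<^sub>3 j + x\<^sub>4 k\<close> is the vector \<open>(x\<^sub>1, x\<^sub>2, x\<^sub>3, x\<^sub>4)\<close> of \<^typ>\<open>real^4\<close>. Quaternion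
  multiplication is never needed: the modulus is the Euclidean norm, and \<open>c\<close> and the
  denominator are real.
\<close>

type_synonym quat = "real^4"

definition qcnj :: "quat \<Rightarrow> quat" where
  "qcnj q = vector [q $ 1, - q $ 2, - q $ 3, - q $ 4]"

definition partial1 :: "(quat \<Rightarrow> quat) \<Rightarrow> quat \<Rightarrow> quat" where
  "partial1 f q = vector_derivative (\<lambda>h. f (q + h *\<^sub>R axis 1 1)) (at 0)"

definition szego :: "nat \<Rightarrow> real \<Rightarrow> quat \<Rightarrow> quat" where
  "szego n c q = c *\<^sub>R (partial1 ^^ (2 * (n - 1))) (\<lambda>p. qcnj p /\<^sub>R norm p ^ 4) q"

text \<open>
  The kernel is undefined on the diagonal; the value \<open>0\<close> there makes no claim bounding the
  kernel away from zero true at a diagonal point.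
\<close>

definition Kfun :: "nat \<Rightarrow> real \<Rightarrow> 'm::finite heis \<Rightarrow> quat" where
  "Kfun n c g = (if g = (0, 0) then 0 else
     szego n c (vector [(norm (snd g))\<^sup>2, fst g $ 1, fst g $ 2, fst g $ 3]))"

definition Kker :: "nat \<Rightarrow> real \<Rightarrow> 'm::finite heis \<Rightarrow> 'm heis \<Rightarrow> quat" where
  "Kker n c g h = Kfun n c (hmult (hinv h) g)"

end

theory Submission
  imports Defs
begin

text \<open>
  The second tile is \<open>T\<close> translated along the centre by \<open>sN\<close> in the first coordinate, \<open>s = \<plusminus>1\<close>, with
  \<open>N = 4\<^sup>a / 2\<close>: every vertical fibre of the ancestor \<open>a\<close> generations above is a cube of side
  \<open>4\<^sup>a\<close> (in units of the generation of \<open>T\<close>), so one of the two signs stays inside it, and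
  the centres are at distance \<open>\<surd>N\<close>. Under the kernel, a pair of points of \<open>T\<close> and its translate
  becomes a quaternion \<open>-sN i\<close> up to a bounded error. At \<open>-s i\<close> the \<open>i\<close>-component of
  the kernel is \<open>s c\<close> times the derivative of order \<open>2(n - 1)\<close> of \<open>(x\<^sup>2 + 1)\<^bsup>-2\<^esup>\<close> at \<open>0\<close>, which does
  not vanish; by homogeneity and continuity it keeps its sign once \<open>N\<close> is large.
\<close>

section \<open>The Szego kernel\<close>

text \<open>
  \<open>phi k r\<close> is the \<open>k\<close>-th derivative of \<open>(x\<^sup>2 + r)\<^bsup>-2\<^esup>\<close>. The recursion comes from applying the Leibniz rule
  to \<open>(x\<^sup>2 + r) \<phi>' = -4 x \<phi>\<close>; the factor \<open>k\<close> makes the junk term \<open>phi (0 - 1)\<close> harmless.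
\<close>

fun phi :: "nat \<Rightarrow> real \<Rightarrow> real \<Rightarrow> real" where
  "phi 0 r x = 1 / (x\<^sup>2 + r)\<^sup>2"
| "phi (Suc k) r x =
     - ((2 * real k + 4) * x * phi k r x + real k * (real k + 3) * phi (k - 1) r x) / (x\<^sup>2 + r)"

text \<open>Strong induction, because the recursion looks back two steps. The quotient rule for the
  recursion at \<open>l\<close> gives \<open>(D - 2 * x * Q) / (x\<^sup>2 + r)\<close>, and the
  coefficients match those at \<open>Suc l\<close> since (2l + 4) + 2 = 2(l + 1) + 4 and (2l + 4) +
  l(l + 3) = (l + 1)(l + 4).\<close>

lemma phi_has_derivative:
  assumes "r > 0"
  shows "(phi k r has_real_derivative phi (Suc k) r x) (at x)"
proof (induction k rule: less_induct)
  case (less k)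
  have pos: "x\<^sup>2 + r > 0" using assms by (simp add: add_nonneg_pos)
  show ?case
  proof (cases k)
    case 0
    have d: "((\<lambda>x. inverse (x\<^sup>2 + r) ^ 2) has_real_derivative
        2 * (inverse (x\<^sup>2 + r) ^ 1 * - (inverse (x\<^sup>2 + r) * (2 * x) * inverse (x\<^sup>2 + r)))) (at x)"
      using pos by (auto intro!: derivative_eq_intros)
    have p0: "phi 0 r = (\<lambda>x. inverse (x\<^sup>2 + r) ^ 2)"
      by (simp add: fun_eq_iff divide_inverse power_inverse)
    have "phi (Suc 0) r x = 2 * (inverse (x\<^sup>2 + r) ^ 1 * - (inverse (x\<^sup>2 + r) * (2 * x) * inverse (x\<^sup>2 + r)))"
      by (simp add: divide_inverse power2_eq_square)
    with d show ?thesis unfolding 0 p0 by simp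
  next
    case (Suc l)
    define P where "P = phi l r x"
    define Q where "Q = phi (Suc l) r x"
    have dl: "(phi l r has_real_derivative Q) (at x)"
      using less.IH[of l] Suc Q_def by simp
    have rec: "(x\<^sup>2 + r) * Q = - ((2 * real l + 4) * x * P + real l * (real l + 3) * phi (l - 1) r x)"
      using pos by (simp add: Q_def P_def)
    have dl1: "((\<lambda>x. real l * (real l + 3) * phi (l - 1) r x) has_real_derivative
        real l * (real l + 3) * P) (at x)"
    proof (cases l)
      case (Suc i)
      then have "(phi (l - 1) r has_real_derivative P) (at x)"
        using less.IH[of i] \<open>k = Suc l\<close> P_def by simp
      then show ?thesis by (rule DERIV_cmult)
    qed simp
    define N where "N = (\<lambda>x. - ((2 * real l + 4) * x * phi l r x + real l * (real l + 3) * phi (l - 1) r x))"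
    define D where "D = - ((2 * real l + 4) * P + (2 * real l + 4) * x * Q + real l * (real l + 3) * P)"
    have "((\<lambda>x. (2 * real l + 4) * x * phi l r x) has_real_derivative
        (2 * real l + 4) * P + (2 * real l + 4) * x * Q) (at x)"
      by (rule derivative_eq_intros refl dl)+ (simp add: P_def)
    then have dN: "(N has_real_derivative D) (at x)"
      unfolding N_def D_def using dl1 by (intro DERIV_minus DERIV_add)
    have dq: "((\<lambda>x. x\<^sup>2 + r) has_real_derivative 2 * x) (at x)"
      by (auto intro!: derivative_eq_intros)
    have "((\<lambda>x. N x / (x\<^sup>2 + r)) has_real_derivative
        (D * (x\<^sup>2 + r) - N x * (2 * x)) / ((x\<^sup>2 + r) * (x\<^sup>2 + r))) (at x)"
      using pos by (intro DERIV_divide dN dq) simp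
    moreover have "N x = (x\<^sup>2 + r) * Q" unfolding rec by (simp add: N_def P_def)
    then have "(D * (x\<^sup>2 + r) - N x * (2 * x)) / ((x\<^sup>2 + r) * (x\<^sup>2 + r)) = (D - 2 * x * Q) / (x\<^sup>2 + r)"
      using pos by (simp add: divide_simps del: phi.simps) (simp add: algebra_simps)
    moreover have "(D - 2 * x * Q) / (x\<^sup>2 + r) = phi (Suc (Suc l)) r x"
      unfolding phi.simps(2)[of "Suc l"] by (simp add: D_def P_def Q_def algebra_simps del: phi.simps)
    moreover have "(\<lambda>x. N x / (x\<^sup>2 + r)) = phi (Suc l) r" by (simp add: fun_eq_iff N_def)
    ultimately show ?thesis by (simp only: Suc)
  qed
qed

text \<open>The function 1 / (x^2 + r)^2 is homogeneous of degree -4 when x has weight 1 and r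
  weight 2; each derivative in x lowers the degree by one. This serves both to extract dilation
  factors from the kernel and to normalise r to 1.\<close>

lemma phi_scale:
  assumes "l > 0"
  shows "phi k (l\<^sup>2 * r) (l * x) = phi k r x / l ^ (k + 4)"
proof (induction k rule: less_induct)
  case (less k)
  have e: "(l * x)\<^sup>2 + l\<^sup>2 * r = l\<^sup>2 * (x\<^sup>2 + r)" by (simp add: algebra_simps)
  show ?case
  proof (cases k)
    case 0
    have "(l\<^sup>2 * (x\<^sup>2 + r))\<^sup>2 = l ^ 4 * (x\<^sup>2 + r)\<^sup>2" by (simp only: power_mult_distrib) simp
    then show ?thesis using 0 by (simp add: e del: power_mult_distrib)
  next
    case (Suc i)
    have 1: "phi i (l\<^sup>2 * r) (l * x) = phi i r x / l ^ (i + 4)" using less Suc by simp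
    \<comment> \<open>For \<open>i = 0\<close> the term \<open>phi (i - 1)\<close> is
      \<open>phi 0\<close>, which scales with the power 4 instead of 3; the factor
      \<open>real i\<close> makes both sides 0 there.\<close>
    have 2: "real i * phi (i - 1) (l\<^sup>2 * r) (l * x) = real i * (phi (i - 1) r x / l ^ (i + 3))"
      using less[of "i - 1"] Suc by (cases i) (auto simp: add.commute)
    have "phi k (l\<^sup>2 * r) (l * x) = - ((2 * real i + 4) * (l * x) * phi i (l\<^sup>2 * r) (l * x)
       + (real i + 3) * (real i * phi (i - 1) (l\<^sup>2 * r) (l * x))) / (l\<^sup>2 * (x\<^sup>2 + r))"
      by (simp add: Suc e)
    also have "\<dots> = - ((2 * real i + 4) * x * phi i r x
       + (real i + 3) * (real i * phi (i - 1) r x)) / l ^ (i + 3) / (l\<^sup>2 * (x\<^sup>2 + r))"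
    proof -
      have "a * (l * x) * (P / l ^ (i + 4)) + b * (real i * (R / l ^ (i + 3))) =
          (a * x * P + b * (real i * R)) / l ^ (i + 3)" for a b P R
        using assms by (simp add: add_divide_distrib numeral_eq_Suc)
      then show ?thesis unfolding 1 2 by (simp only: minus_divide_left)
    qed
    also have "\<dots> = phi k r x / l ^ (k + 4)"
    proof -
      have "W / l ^ (i + 3) / (l\<^sup>2 * V) = W / V / l ^ (Suc i + 4)" for W V
        by (simp add: power_add numeral_eq_Suc mult_ac)
      note this[of "- ((2 * real i + 4) * x * phi i r x + (real i + 3) * (real i * phi (i - 1) r x))" "x\<^sup>2 + r"]
      moreover have "(real i + 3) * (real i * phi (i - 1) r x) = real i * (real i + 3) * phi (i - 1) r x"
        by simp
      ultimately show ?thesis unfolding Suc phi.simps(2) by argo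
    qed
    finally show ?thesis .
  qed
qed

text \<open>At x = 0 and r = 1 the recursion reduces to multiplication by -k(k + 3) from order k - 1
  to order k + 1, which is nonzero for odd k.\<close>

lemma phi_even_at_0: "phi (2 * m) 1 0 \<noteq> 0"
  by (induction m) auto

lemma isCont_phi: "r > 0 \<Longrightarrow> isCont (phi k r) x"
  using phi_has_derivative DERIV_isCont by blast

section \<open>Iterated derivatives of the conjugate over the fourth power of the modulus\<close>

lemma norm_quat_sq: "(norm (p :: quat))\<^sup>2 = (p $ 1)\<^sup>2 + ((p $ 2)\<^sup>2 + (p $ 3)\<^sup>2 + (p $ 4)\<^sup>2)"
  by (simp add: norm_vec_def L2_set_def sum_4 sum_nonneg)

text \<open>Along the first axis the squared modulus is x^2 + r with r constant, and the conjugate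
  is affine with derivative \<open>axis 1 1\<close>, so the Leibniz rule leaves two terms. As r > 0,
  the whole line avoids the singularity at 0.\<close>

lemma partial1_iter:
  assumes "r > 0" and "(p $ 2)\<^sup>2 + (p $ 3)\<^sup>2 + (p $ 4)\<^sup>2 = r"
  shows "(partial1 ^^ k) (\<lambda>p. qcnj p /\<^sub>R norm p ^ 4) p =
    phi k r (p $ 1) *\<^sub>R qcnj p + (real k * phi (k - 1) r (p $ 1)) *\<^sub>R axis 1 1"
  using assms(2)
proof (induction k arbitrary: p)
  case 0
  have "norm p ^ 4 = ((norm p)\<^sup>2)\<^sup>2" by simp
  also have "\<dots> = ((p $ 1)\<^sup>2 + r)\<^sup>2" by (simp only: norm_quat_sq 0)
  finally show ?case by (simp add: divide_inverse)
next
  case (Suc k)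
  let ?x = "p $ 1"
  have q: "qcnj (p + h *\<^sub>R axis 1 1) = qcnj p + h *\<^sub>R axis 1 1" for h
    by (simp add: qcnj_def vec_eq_iff forall_4 axis_def)
  \<comment> \<open>Moving along the first axis preserves the premise on r, so the induction
    hypothesis holds on the whole line and can be differentiated.\<close>
  have line: "(partial1 ^^ k) (\<lambda>p. qcnj p /\<^sub>R norm p ^ 4) (p + h *\<^sub>R axis 1 1) =
     phi k r (?x + h) *\<^sub>R (qcnj p + h *\<^sub>R axis 1 1) + (real k * phi (k - 1) r (?x + h)) *\<^sub>R axis 1 1" for h
    using Suc.IH[of "p + h *\<^sub>R axis 1 1"] Suc.prems by (simp add: q) (simp add: axis_def)
  have d: "((\<lambda>h. phi i r (?x + h)) has_real_derivative phi (Suc i) r ?x) (at 0)" for i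
    using phi_has_derivative[OF assms(1), of i ?x] DERIV_shift[of "phi i r" "phi (Suc i) r ?x" 0 ?x]
    by (simp add: add.commute del: phi.simps)
  have d1: "((\<lambda>h. real k * phi (k - 1) r (?x + h)) has_real_derivative real k * phi k r ?x) (at 0)"
    using DERIV_cmult[OF d[of "k - 1"], of "real k"] by (cases k) (simp_all del: phi.simps)
  have "((\<lambda>h. phi k r (?x + h) *\<^sub>R (qcnj p + h *\<^sub>R axis 1 1) + (real k * phi (k - 1) r (?x + h)) *\<^sub>R axis 1 1)
     has_vector_derivative
     phi (Suc k) r ?x *\<^sub>R qcnj p + (real (Suc k) * phi k r ?x) *\<^sub>R axis 1 1) (at 0)"
    by (rule derivative_eq_intros refl d d1)+ (simp add: algebra_simps del: phi.simps)
  then show ?case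
    using vector_derivative_at unfolding funpow.simps o_def partial1_def[of "(partial1 ^^ k) _"] line
    by force
qed

text \<open>The second Leibniz term is real, so an imaginary component sees only the first; the
  minus sign comes from conjugation.\<close>

lemma szego_2:
  assumes "r > 0" and "(p $ 2)\<^sup>2 + (p $ 3)\<^sup>2 + (p $ 4)\<^sup>2 = r"
  shows "szego n c p $ 2 = - c * phi (2 * (n - 1)) r (p $ 1) * p $ 2"
  unfolding szego_def partial1_iter[OF assms] by (simp add: qcnj_def axis_def del: phi.simps)

section \<open>Nesting of tiles\<close>

lemma Bform_add_left: "Bform (x + y) z = Bform x z + Bform y z"
  by (simp add: Bform_def vec_eq_iff sum.distrib algebra_simps)

lemma Bform_add_right: "Bform x (y + z) = Bform x y + Bform x z"
  by (simp add: Bform_def vec_eq_iff sum.distrib algebra_simps)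

lemma Bform_diff_right: "Bform x (y - z) = Bform x y - Bform x z"
  using Bform_add_right[of x y "- z"] by (simp add: Bform_uminus_right)

lemma Bform_scaleR_left: "Bform (r *\<^sub>R x) y = r *\<^sub>R Bform x y"
  by (simp add: Bform_def vec_eq_iff sum_distrib_left mult_ac)

lemma Bform_scaleR_right: "Bform x (r *\<^sub>R y) = r *\<^sub>R Bform x y"
  by (simp add: Bform_def vec_eq_iff sum_distrib_left mult_ac)

lemma bmat_Ints: "bmat $ a $ k $ j \<in> \<int>"
  using exhaust_3[of a] exhaust_4[of k] exhaust_4[of j] by (auto simp: bmat_def)

lemma abs_bmat_le: "\<bar>bmat $ a $ k $ j\<bar> \<le> 1"
  using exhaust_3[of a] exhaust_4[of k] exhaust_4[of j] by (auto simp: bmat_def)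

lemma Bform_Ints:
  assumes "\<forall>l k. x $ l $ k \<in> \<int>" "\<forall>l k. y $ l $ k \<in> \<int>"
  shows "Bform x y $ a \<in> \<int>"
  using assms bmat_Ints by (auto simp: Bform_def intro!: Ints_mult Ints_sum)

lemma abs_Bform_le:
  fixes x y :: "real^4^'m"
  assumes "\<forall>l k. \<bar>x $ l $ k\<bar> \<le> 1" "\<forall>l k. \<bar>y $ l $ k\<bar> \<le> 1"
  shows "\<bar>Bform x y $ a\<bar> \<le> 32 * real CARD('m)"
proof -
  have "\<bar>\<Sum>l\<in>UNIV. \<Sum>j\<in>UNIV. \<Sum>k\<in>UNIV. bmat $ a $ k $ j * x $ l $ k * y $ l $ j\<bar>
     \<le> (\<Sum>l\<in>(UNIV :: 'm set). \<Sum>j\<in>(UNIV :: 4 set). \<Sum>k\<in>(UNIV :: 4 set). 1)"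
    using assms by (intro order.trans[OF sum_abs] sum_mono)
      (auto simp: abs_mult intro!: mult_le_one abs_bmat_le)
  \<comment> \<open>Each block has 16 products of modulus at most 1, and the form carries a factor
    2: hence 32 per block.\<close>
  then show ?thesis by (simp add: Bform_def)
qed

section \<open>The series \<open>Fser\<close>\<close>

lemma digits_bounds: "\<bar>digits m y $ l $ k\<bar> \<le> 1"
proof -
  have "\<lfloor>2 ^ m * y $ l $ k\<rfloor> mod 2 = 0 \<or> \<lfloor>2 ^ m * y $ l $ k\<rfloor> mod 2 = 1" by presburger
  then show ?thesis by (auto simp: digits_def)
qed

lemma fracpart_bounds: "\<bar>fracpart m y $ l $ k\<bar> \<le> 1"
  by (simp add: fracpart_def frac_ge_0 order.strict_implies_order[OF frac_lt_1])

lemma Fser_term_bound: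
  fixes y :: "real^4^'m"
  shows "norm (Bform (digits (Suc i) y) (fracpart (Suc i) y) $ a / 4 ^ Suc i)
    \<le> 32 * real CARD('m) * (1 / 4) ^ Suc i"
proof -
  have "\<bar>Bform (digits (Suc i) y) (fracpart (Suc i) y) $ a\<bar> / 4 ^ Suc i \<le> 32 * real CARD('m) / 4 ^ Suc i"
    by (intro divide_right_mono abs_Bform_le allI digits_bounds fracpart_bounds) simp
  then show ?thesis by (simp add: power_divide)
qed

lemma Fser_summable:
  "summable (\<lambda>i. Bform (digits (Suc i) y) (fracpart (Suc i) y) $ a / 4 ^ Suc i)"
  by (rule summable_comparison_test'[where N = 0, OF _ Fser_term_bound])
     (simp add: summable_mult summable_geometric)

lemma abs_Fser_le:
  fixes y :: "real^4^'m"
  shows "\<bar>Fser y $ a\<bar> \<le> 32 * real CARD('m)"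
proof -
  have s: "summable (\<lambda>i. 32 * real CARD('m) * (1 / 4) ^ Suc i)"
    by (simp add: summable_mult summable_geometric)
  have "norm (\<Sum>i. Bform (digits (Suc i) y) (fracpart (Suc i) y) $ a / 4 ^ Suc i)
     \<le> (\<Sum>i. 32 * real CARD('m) * (1 / 4) ^ Suc i)"
    by (rule norm_suminf_le[OF Fser_term_bound s])
  also have "\<dots> = 32 * real CARD('m) * ((\<Sum>i. (1 / 4) ^ i) / 4)"
    by (simp add: suminf_mult suminf_divide summable_geometric summable_mult)
  also have "\<dots> \<le> 32 * real CARD('m)" by (simp add: suminf_geometric)
  finally show ?thesis by (simp add: Fser_def)
qed

text \<open>The series starts at m = 1, so an integer shift of y changes 2^m y by an even integer,
  which neither the digit modulo 2 nor the fractional part sees.\<close>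

lemma Fser_add_Ints:
  assumes "\<forall>l k. e $ l $ k \<in> \<int>"
  shows "Fser (e + y) = Fser y"
proof -
  have "digits (Suc i) (e + y) = digits (Suc i) y \<and> fracpart (Suc i) (e + y) = fracpart (Suc i) y" for i
  proof -
    have "\<lfloor>2 ^ Suc i * (e $ l $ k + y $ l $ k)\<rfloor> mod 2 = \<lfloor>2 ^ Suc i * y $ l $ k\<rfloor> mod 2 \<and>
      frac (2 ^ Suc i * (e $ l $ k + y $ l $ k)) = frac (2 ^ Suc i * y $ l $ k)" for l k
    proof -
      obtain z :: int where "e $ l $ k = of_int z" using assms Ints_cases by blast
      then have "2 ^ Suc i * (e $ l $ k + y $ l $ k) = 2 ^ Suc i * y $ l $ k + of_int (2 * (2 ^ i * z))"
        by (simp add: algebra_simps)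
      moreover have "\<lfloor>w + of_int (2 * v)\<rfloor> mod 2 = \<lfloor>w\<rfloor> mod 2 \<and> frac (w + of_int (2 * v)) = frac w"
        for w :: real and v by (simp only: floor_add_int[symmetric] frac_def) simp
      ultimately show ?thesis by presburger
    qed
    then show ?thesis by (simp add: digits_def fracpart_def vec_eq_iff del: power_Suc)
  qed
  then show ?thesis by (simp add: Fser_def)
qed

text \<open>Since \<open>(e + y) / 2\<close> has first binary digits \<open>e\<close>, this is the self-similarity behind the nesting of tiles.\<close>

lemma Fser_half:
  assumes e: "\<forall>l k. e $ l $ k = 0 \<or> e $ l $ k = 1"
    and y: "\<forall>l k. 0 \<le> y $ l $ k \<and> y $ l $ k < 1"
  shows "4 * Fser ((1 / 2) *\<^sub>R (e + y)) $ a = Bform e y $ a + Fser y $ a"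
proof -
  let ?z = "(1 / 2) *\<^sub>R (e + y)"
  let ?f = "\<lambda>i. Bform (digits (Suc i) ?z) (fracpart (Suc i) ?z) $ a / 4 ^ Suc i"
  have eI: "\<forall>l k. e $ l $ k \<in> \<int>" using e by (metis Ints_0 Ints_1)
  have d: "digits (Suc i) ?z = digits i (e + y)" "fracpart (Suc i) ?z = fracpart i (e + y)" for i
  proof -
    have "2 ^ Suc i * ?z $ l $ k = 2 ^ i * (e + y) $ l $ k" for l k by simp
    then show "digits (Suc i) ?z = digits i (e + y)" "fracpart (Suc i) ?z = fracpart i (e + y)"
      by (simp_all only: digits_def fracpart_def)
  qed
  have fl: "\<lfloor>e $ l $ k + y $ l $ k\<rfloor> mod 2 = e $ l $ k \<and> frac (e $ l $ k + y $ l $ k) = y $ l $ k" for l k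
  proof -
    have "\<lfloor>y $ l $ k\<rfloor> = 0" using y by (simp add: floor_eq_iff)
    then have "\<lfloor>1 + y $ l $ k\<rfloor> = 1" by (metis add.commute add_0 floor_add_int of_int_1)
    with \<open>\<lfloor>y $ l $ k\<rfloor> = 0\<close> show ?thesis using spec[OF spec[OF e, of l], of k] by (auto simp: frac_def)
  qed
  have d0: "digits 0 (e + y) = e" "fracpart 0 (e + y) = y"
    using fl by (simp_all add: digits_def fracpart_def vec_eq_iff)
  have "Fser ?z $ a = suminf ?f" by (simp add: Fser_def)
  \<comment> \<open>Halving moves the index by one: the head is the index 0 term of
    \<open>e + y\<close>, namely B(e, y) / 4, and the tail is the series of \<open>e + y\<close>
    divided by 4.\<close>
  also have "\<dots> = ?f 0 + (\<Sum>i. ?f (Suc i))"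
    using suminf_split_head[OF Fser_summable[of ?z a]] by simp
  also have "(\<Sum>i. ?f (Suc i)) =
      (\<Sum>i. Bform (digits (Suc i) (e + y)) (fracpart (Suc i) (e + y)) $ a / 4 ^ Suc i / 4)"
    unfolding d by (simp add: mult_ac)
  also have "\<dots> = Fser (e + y) $ a / 4"
    unfolding Fser_def using suminf_divide[OF Fser_summable[of "e + y" a], of 4] by simp
  finally show ?thesis by (simp add: Fser_add_Ints[OF eI] d d0)
qed

section \<open>Membership, disjointness and parents in generation 0\<close>

lemma mem_ltrans_tile:
  fixes g :: "'m::finite heis"
  assumes "g \<in> heisZ"
  shows "p \<in> ltrans g ` basic_tile \<longleftrightarrow>
    (\<forall>l k. snd g $ l $ k \<le> snd p $ l $ k \<and> snd p $ l $ k < snd g $ l $ k + 1) \<and>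
    (\<forall>a. fst g $ a + Bform (snd g) (snd p) $ a + Fser (snd p) $ a \<le> fst p $ a \<and>
         fst p $ a < fst g $ a + Bform (snd g) (snd p) $ a + Fser (snd p) $ a + 1)" (is "_ \<longleftrightarrow> ?R")
proof -
  let ?q = "(fst p - fst g - Bform (snd g) (snd p), snd p - snd g)"
  have "\<forall>l k. (- snd g) $ l $ k \<in> \<int>" using assms by (auto simp: heisZ_def)
  \<comment> \<open>Integer invariance lets the translated tile be described by \<open>Fser\<close>
    at the point itself: a unit cube in y, with unit cubes as vertical fibres.\<close>
  then have F: "Fser (snd p - snd g) = Fser (snd p)"
    using Fser_add_Ints[of "- snd g" "snd p"] by simp
  have eq: "p = ltrans g q \<longleftrightarrow> q = ?q" for q
    by (auto simp: ltrans_def hmult_def prod_eq_iff Bform_diff_right Bform_self Bform_add_right)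
  have "p \<in> ltrans g ` basic_tile \<longleftrightarrow> ?q \<in> basic_tile" by (simp add: image_iff eq)
  also have "\<dots> \<longleftrightarrow> ?R" by (auto simp: basic_tile_def F algebra_simps)
  finally show ?thesis .
qed

text \<open>An integer u is determined by any w in [u, u + 1). This fixes the y-part of the lattice
  point first; the vertical offset is then common to both tiles, and the same argument fixes the
  t-part.\<close>

lemma tile0_disjoint:
  fixes g h :: "'m::finite heis"
  assumes g: "g \<in> heisZ" and h: "h \<in> heisZ"
    and "p \<in> ltrans g ` basic_tile" "p \<in> ltrans h ` basic_tile"
  shows "g = h"
proof -
  have un: "u = v" if "u \<in> \<int>" "v \<in> \<int>" "u \<le> w" "w < u + 1" "v \<le> w" "w < v + 1" for u v w :: real
    using that by (smt (verit) Ints_cases floor_unique of_int_1)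
  note m = assms(3)[unfolded mem_ltrans_tile[OF g]] assms(4)[unfolded mem_ltrans_tile[OF h]]
  have s: "snd g $ l $ k = snd h $ l $ k" for l k
    by (rule un[of _ _ "snd p $ l $ k"]) (use g h m in \<open>auto simp: heisZ_def\<close>)
  then have s: "snd g = snd h" by (simp add: vec_eq_iff)
  have "fst g $ a = fst h $ a" for a
    by (rule un[of _ _ "fst p $ a - Bform (snd h) (snd p) $ a - Fser (snd p) $ a"])
       (use g h m s in \<open>auto simp: heisZ_def algebra_simps\<close>)
  then show ?thesis using s by (simp add: prod_eq_iff vec_eq_iff)
qed

text \<open>The y-part of the parent is the integer part of half the y-part of \<open>g\<close>,
  with remainder digits \<open>e\<close>; the t-part is an integer part after division by 4.\<close>

lemma tile0_parent:
  fixes g :: "'m::finite heis"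
  assumes g: "g \<in> heisZ"
  obtains h where "h \<in> heisZ" "ltrans g ` basic_tile \<subseteq> dil 2 ` ltrans h ` basic_tile"
proof -
  define hy :: "real^4^'m" where "hy = (\<chi> l k. of_int \<lfloor>snd g $ l $ k / 2\<rfloor>)"
  define e where "e = snd g - 2 *\<^sub>R hy"
  \<comment> \<open>For a point (t, y) of the basic tile, 4 times the vertical coordinate relative
    to the parent is t + B(e, y) + (w - 4 ht), whatever y is.\<close>
  define w where "w = fst g - 2 *\<^sub>R Bform hy e"
  define ht :: "real^3" where "ht = (\<chi> a. of_int \<lfloor>w $ a / 4\<rfloor>)"
  have hI: "\<forall>l k. hy $ l $ k \<in> \<int>" by (simp add: hy_def)
  have e01: "\<forall>l k. e $ l $ k = 0 \<or> e $ l $ k = 1"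
  proof (intro allI)
    fix l k
    have "snd g $ l $ k \<in> \<int>" using g by (auto simp: heisZ_def)
    then obtain z where "snd g $ l $ k = of_int z" by (rule Ints_cases)
    moreover have "\<lfloor>real_of_int z / 2\<rfloor> = z div 2" using floor_divide_of_int_eq[of z 2] by simp
    ultimately have "e $ l $ k = of_int (z - 2 * (z div 2))" by (simp add: e_def hy_def)
    moreover have "z - 2 * (z div 2) = 0 \<or> z - 2 * (z div 2) = 1" by presburger
    ultimately show "e $ l $ k = 0 \<or> e $ l $ k = 1" by auto
  qed
  have eI: "\<forall>l k. e $ l $ k \<in> \<int>" using e01 by (metis Ints_0 Ints_1)
  \<comment> \<open>Integrality of \<open>w\<close> gives the bound 3 rather than < 4, which leaves
    room for the unit fibre of the child.\<close>
  have w4: "0 \<le> w $ a - 4 * ht $ a \<and> w $ a - 4 * ht $ a \<le> 3" for a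
  proof -
    have "fst g $ a \<in> \<int>" "Bform hy e $ a \<in> \<int>"
      using g Bform_Ints[OF hI eI] by (auto simp: heisZ_def)
    then have "w $ a \<in> \<int>" by (simp add: w_def)
    then obtain z where z: "w $ a = of_int z" by (auto elim: Ints_cases)
    have "\<lfloor>real_of_int z / 4\<rfloor> = z div 4" using floor_divide_of_int_eq[of z 4] by simp
    then have "w $ a - 4 * ht $ a = of_int (z - 4 * (z div 4))" by (simp add: ht_def z)
    moreover have "0 \<le> z - 4 * (z div 4) \<and> z - 4 * (z div 4) \<le> 3" by presburger
    ultimately show ?thesis by (metis of_int_0_le_iff of_int_le_numeral_iff)
  qed
  have h: "(ht, hy) \<in> heisZ" using hI by (simp add: heisZ_def ht_def)
  have sub: "ltrans g (t, y) \<in> dil 2 ` ltrans (ht, hy) ` basic_tile" if ty: "(t, y) \<in> basic_tile" for t y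
  proof -
    \<comment> \<open>The coordinates relative to \<open>(ht, hy)\<close> of the image of (t, y)
      under translation by \<open>g\<close> and dilation by 1/2.\<close>
    define y' where "y' = (1 / 2) *\<^sub>R (e + y)"
    define t' where "t' = (1 / 4) *\<^sub>R (fst g + t + Bform (snd g) y) - ht - Bform hy y'"
    have sg: "snd g = 2 *\<^sub>R hy + e" by (simp add: e_def)
    have y01: "\<forall>l k. 0 \<le> y $ l $ k \<and> y $ l $ k < 1" using ty by (simp add: basic_tile_def)
    have t': "4 * t' $ a = t $ a + Bform e y $ a + (w $ a - 4 * ht $ a)" for a
      by (simp add: t'_def sg w_def y'_def Bform_add_left Bform_add_right Bform_scaleR_left
          Bform_scaleR_right algebra_simps)
    have "(t', y') \<in> basic_tile" unfolding basic_tile_def mem_Collect_eq prod.case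
    proof (intro conjI allI)
      fix l k show "0 \<le> y' $ l $ k" "y' $ l $ k < 1"
        using e01[rule_format, of l k] y01[rule_format, of l k] by (auto simp: y'_def)
    next
      fix a
      have "Fser y $ a \<le> t $ a \<and> t $ a < Fser y $ a + 1" using ty by (simp add: basic_tile_def)
      \<comment> \<open>Self-similarity cancels B(e, y): 4 (t' - F(y')) = (t - F(y)) + (w - 4 ht),
        where the first summand lies in [0, 1) and the second in [0, 3], so the total is in [0,
        4).\<close>
      then show "Fser y' $ a \<le> t' $ a" "t' $ a < Fser y' $ a + 1"
        using Fser_half[OF e01 y01, of a, folded y'_def] t'[of a] w4[of a] by linarith+
    qed
    moreover have "dil 2 (ltrans (ht, hy) (t', y')) = ltrans g (t, y)"
      by (simp add: dil_def ltrans_def hmult_def t'_def y'_def sg vec_eq_iff)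
    ultimately show ?thesis by (metis imageI)
  qed
  have "ltrans g ` basic_tile \<subseteq> dil 2 ` ltrans (ht, hy) ` basic_tile"
    by (rule image_subsetI) (metis sub prod.collapse)
  then show ?thesis by (rule that[OF h])
qed

section \<open>Tiles of all generations and their ancestors\<close>

lemma dil_dil: "dil r (dil s g) = dil (r * s) g"
  by (simp add: dil_def power_mult_distrib)

lemma tilesE:
  assumes "T \<in> tiles j"
  obtains g where "g \<in> heisZ" "T = dil (2 powi j) ` ltrans g ` basic_tile"
  using assms by (auto simp: tiles_def tiles0_def)

lemma tilesI: "g \<in> heisZ \<Longrightarrow> dil (2 powi j) ` ltrans g ` basic_tile \<in> tiles j"
  unfolding tiles_def tiles0_def by blast

lemma tile_nonempty:
  fixes T :: "'m::finite heis set"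
  assumes "T \<in> tiles j"
  shows "T \<noteq> {}"
proof -
  have "(Fser (0 :: real^4^'m), 0 :: real^4^'m) \<in> basic_tile" by (simp add: basic_tile_def)
  then show ?thesis using assms by (auto elim!: tilesE)
qed

lemma inj_dil: "r \<noteq> 0 \<Longrightarrow> inj (dil r)"
  by (auto simp: inj_on_def dil_def prod_eq_iff)

lemma tiles_disjoint:
  assumes "T \<in> tiles j" "T' \<in> tiles j" "p \<in> T" "p \<in> T'"
  shows "T = T'"
proof -
  obtain g where g: "g \<in> heisZ" "T = dil (2 powi j) ` ltrans g ` basic_tile"
    using assms(1) by (rule tilesE)
  obtain h where h: "h \<in> heisZ" "T' = dil (2 powi j) ` ltrans h ` basic_tile"
    using assms(2) by (rule tilesE)
  have "inj (dil (2 powi j) :: 'a heis \<Rightarrow> _)" by (simp add: inj_dil)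
  then obtain q where "q \<in> ltrans g ` basic_tile" "q \<in> ltrans h ` basic_tile"
    using assms(3,4) g(2) h(2) by (auto dest!: injD)
  then show ?thesis using tile0_disjoint g h by blast
qed

lemma tile_parent:
  assumes "T \<in> tiles j"
  shows "\<exists>T'\<in>tiles (j + 1). T \<subseteq> T'"
proof -
  obtain g where g: "g \<in> heisZ" "T = dil (2 powi j) ` ltrans g ` basic_tile"
    using assms by (rule tilesE)
  obtain h where h: "h \<in> heisZ" "ltrans g ` basic_tile \<subseteq> dil 2 ` ltrans h ` basic_tile"
    using tile0_parent[OF g(1)] .
  have "T \<subseteq> dil (2 powi j) ` dil 2 ` ltrans h ` basic_tile"
    unfolding g(2) by (rule image_mono[OF h(2)])
  also have "\<dots> = dil (2 powi (j + 1)) ` ltrans h ` basic_tile"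
    by (simp add: image_image dil_dil power_int_add)
  finally show ?thesis using tilesI[OF h(1)] by blast
qed

lemma tile_ancestor:
  assumes "T \<in> tiles j"
  shows "\<exists>!T'. T' \<in> tiles (j + int a) \<and> T \<subseteq> T'"
proof -
  have "\<exists>T'\<in>tiles (j + int a). T \<subseteq> T'"
  proof (induction a)
    case 0
    then show ?case using assms by auto
  next
    case (Suc a)
    then obtain T' where T': "T' \<in> tiles (j + int a)" "T \<subseteq> T'" by blast
    obtain T'' where "T'' \<in> tiles (j + int a + 1)" "T' \<subseteq> T''"
      using tile_parent[OF T'(1)] by blast
    moreover have "j + int a + 1 = j + int (Suc a)" by simp
    ultimately show ?case using T'(2) by (metis order.trans)
  qed
  then show ?thesis using tiles_disjoint tile_nonempty[OF assms] by blast
qed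

lemma ancestor_tile:
  assumes "T \<in> tiles j"
  shows "ancestor a j T \<in> tiles (j + int a)" "T \<subseteq> ancestor a j T"
  using theI'[OF tile_ancestor[OF assms, of a]] by (auto simp: ancestor_def)

text \<open>Tiles of one generation that meet are equal, so one common point already identifies the
  ancestor.\<close>

lemma ancestor_eqI:
  assumes "T \<in> tiles j" "T' \<in> tiles (j + int a)" "p \<in> T" "p \<in> T'"
  shows "ancestor a j T = T'"
  using assms ancestor_tile[OF assms(1), of a] tiles_disjoint by blast

section \<open>Translations along the centre\<close>

definition cshift :: "real \<Rightarrow> 'm::finite heis \<Rightarrow> 'm heis" where
  "cshift s g = (fst g + s *\<^sub>R axis 1 1, snd g)"

lemma cshift_dil: "r \<noteq> 0 \<Longrightarrow> cshift s (dil r g) = dil r (cshift (s / r\<^sup>2) g)"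
  by (simp add: cshift_def dil_def algebra_simps)

text \<open>\<open>cshift s\<close> is multiplication by a central element, so it can be moved to
  either factor of a product. This trades a shifted lattice point for a shifted point of the basic
  tile.\<close>

lemma cshift_ltrans: "cshift s (ltrans g p) = ltrans g (cshift s p)"
  "cshift s (ltrans g p) = ltrans (cshift s g) p"
  by (simp_all add: cshift_def ltrans_def hmult_def)

lemma half_shift:
  assumes "T \<in> tiles j" "p \<in> T"
  obtains s where "s = 1 \<or> s = -1" "cshift (s * (2 powi j)\<^sup>2 / 2) p \<in> T"
proof -
  obtain g where g: "T = dil (2 powi j) ` ltrans g ` basic_tile"
    using assms(1) by (rule tilesE)
  then obtain t y where ty: "(t, y) \<in> basic_tile" and p: "p = dil (2 powi j) (ltrans g (t, y))"
    using assms(2) by auto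
  \<comment> \<open>The fibre is an interval of length 1 in the first coordinate: from its lower
    half a shift by 1/2 goes up, from its upper half down.\<close>
  define s :: real where "s = (if t $ 1 < Fser y $ 1 + 1 / 2 then 1 else -1)"
  have "cshift (s / 2) (t, y) \<in> basic_tile"
    using ty by (auto simp: basic_tile_def cshift_def s_def axis_def forall_3)
  then have "dil (2 powi j) (ltrans g (cshift (s / 2) (t, y))) \<in> T" using g by blast
  moreover have "cshift (s * (2 powi j)\<^sup>2 / 2) p = dil (2 powi j) (ltrans g (cshift (s / 2) (t, y)))"
    unfolding p by (simp add: cshift_dil cshift_ltrans(1))
  ultimately show ?thesis using that[of s] by (auto simp: s_def split: if_splits)
qed

section \<open>Pairs of tiles\<close>

text \<open>Polarisation of B(x, x) = 0.\<close>

lemma Bform_skew: "Bform x y = - Bform y x"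
proof -
  have "Bform (x + y) (x + y) = Bform x y + Bform y x"
    unfolding Bform_add_left Bform_add_right by (simp add: Bform_self)
  then show ?thesis unfolding Bform_self by (metis eq_neg_iff_add_eq_0)
qed

section \<open>Left invariance and homogeneity of the group difference\<close>

lemma hmult_hinv_ltrans: "hmult (hinv (ltrans g x)) (ltrans g z) = hmult (hinv x) z"
  using Bform_skew[of "snd x" "snd g"]
  by (simp add: ltrans_def hmult_def hinv_def Bform_add_left Bform_add_right Bform_uminus_left
      Bform_self Bform_diff_right flip: minus_add_distrib)

lemma hmult_hinv_dil: "hmult (hinv (dil r x)) (dil r z) = dil r (hmult (hinv x) z)"
  by (simp add: dil_def hmult_def hinv_def Bform_uminus_left Bform_scaleR_left Bform_scaleR_right
      algebra_simps power2_eq_square)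

lemma hnorm_dil: "r \<ge> 0 \<Longrightarrow> hnorm (dil r g) = r * hnorm g"
proof -
  assume r: "r \<ge> 0"
  have "(r * norm (snd g)) ^ 4 + (r\<^sup>2 * norm (fst g))\<^sup>2 = r ^ 4 * (norm (snd g) ^ 4 + (norm (fst g))\<^sup>2)"
    by (simp add: power_mult_distrib algebra_simps)
  then show ?thesis using r
    by (simp add: hnorm_def dil_def real_root_mult real_root_power_cancel)
qed

lemma hdist_cshift:
  assumes "r \<ge> 0"
  shows "hdist (dil r (ltrans g p)) (dil r (ltrans (cshift s g) p)) = r * root 4 (s\<^sup>2)"
proof -
  have "hmult (hinv (cshift s p)) p = (- s *\<^sub>R axis 1 1, 0)"
    by (simp add: cshift_def hmult_def hinv_def Bform_uminus_left Bform_self)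
  then show ?thesis using assms
    by (simp add: hdist_def hmult_hinv_dil hmult_hinv_ltrans hnorm_dil
        cshift_ltrans(2)[symmetric] cshift_ltrans(1))
       (simp add: hnorm_def)
qed

section \<open>Bounds over pairs of points and for the kernel\<close>

lemma basic_tile_diff:
  fixes a b :: "'m::finite heis"
  assumes "a \<in> basic_tile" "b \<in> basic_tile"
  shows "norm (snd (hmult (hinv b) a)) \<le> 4 * real CARD('m)"
    and "\<bar>fst (hmult (hinv b) a) $ i\<bar> \<le> 96 * real CARD('m) + 1"
proof -
  let ?M = "32 * real CARD('m)"
  have A: "\<forall>l k. 0 \<le> snd a $ l $ k \<and> snd a $ l $ k < 1" "\<forall>l k. 0 \<le> snd b $ l $ k \<and> snd b $ l $ k < 1"
    "\<forall>i. Fser (snd a) $ i \<le> fst a $ i \<and> fst a $ i < Fser (snd a) $ i + 1"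
    "\<forall>i. Fser (snd b) $ i \<le> fst b $ i \<and> fst b $ i < Fser (snd b) $ i + 1"
    using assms by (auto simp: basic_tile_def)
  let ?v = "- snd b + snd a"
  have "norm ?v \<le> (\<Sum>l\<in>UNIV. norm (?v $ l))"
    unfolding norm_vec_def by (rule L2_set_le_sum) simp
  also have "\<dots> \<le> (\<Sum>l\<in>(UNIV :: 'm set). 4)"
  proof (rule sum_mono)
    fix l
    have "norm (?v $ l) \<le> (\<Sum>k\<in>UNIV. \<bar>?v $ l $ k\<bar>)" by (rule norm_le_l1_cart)
    also have "\<dots> \<le> (\<Sum>k\<in>(UNIV :: 4 set). 1)"
    proof (rule sum_mono)
      fix k show "\<bar>?v $ l $ k\<bar> \<le> 1"
        using A(1)[rule_format, of l k] A(2)[rule_format, of l k] by (auto simp: abs_le_iff)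
    qed
    finally show "norm (?v $ l) \<le> 4" by simp
  qed
  finally show "norm (snd (hmult (hinv b) a)) \<le> 4 * real CARD('m)"
    by (simp add: hmult_def hinv_def)
  have "\<bar>Bform (snd b) (snd a) $ i\<bar> \<le> ?M"
    by (rule abs_Bform_le) (use A in \<open>auto simp: less_imp_le\<close>)
  \<comment> \<open>Two values of \<open>Fser\<close> and one of \<open>Bform\<close> contribute 32
    \<open>CARD('m)\<close> each; the summand 1 is the height of the fibre.\<close>
  then show "\<bar>fst (hmult (hinv b) a) $ i\<bar> \<le> 96 * real CARD('m) + 1"
    using abs_Fser_le[of "snd a" i] abs_Fser_le[of "snd b" i]
      A(3)[rule_format, of i] A(4)[rule_format, of i]
    by (auto simp: abs_le_iff hmult_def hinv_def Bform_uminus_left)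
qed

text \<open>The kernel estimate in real variables: x stands for |y|^2 and w for t. With R = |w|,
  scaling turns \<open>phi\<close> at (R^2, x) into its value at (1, x / R) divided by R^(2m + 4).
  For large N the quotient x / R is small, so continuity at 0 and the nonvanishing value there fix
  the sign and half the size.\<close>

lemma phi_lower_bound:
  fixes D E :: real
  assumes D: "D \<ge> 0" and E: "E \<ge> 0"
  shows "\<exists>N0. \<forall>N\<ge>N0. \<exists>C>0. \<forall>s x w1 w2 w3.
      (s = 1 \<or> s = -1) \<longrightarrow> 0 \<le> x \<longrightarrow> x \<le> D \<longrightarrow> \<bar>w1 + s * N\<bar> \<le> E \<longrightarrow> \<bar>w2\<bar> \<le> E \<longrightarrow> \<bar>w3\<bar> \<le> E \<longrightarrow>
      w1\<^sup>2 + w2\<^sup>2 + w3\<^sup>2 > 0 \<and>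
      C \<le> - s * sgn (phi (2 * m) 1 0) * (phi (2 * m) (w1\<^sup>2 + w2\<^sup>2 + w3\<^sup>2) x * w1)"
proof -
  define f0 where "f0 = phi (2 * m) 1 0"
  have f0: "\<bar>f0\<bar> > 0" using phi_even_at_0 by (simp add: f0_def)
  have "isCont (phi (2 * m) 1) 0" by (rule isCont_phi) simp
  then obtain d where d: "d > 0" "\<And>u. \<bar>u\<bar> < d \<Longrightarrow> \<bar>phi (2 * m) 1 u - f0\<bar> < \<bar>f0\<bar> / 2"
    using f0 unfolding continuous_at_eps_delta f0_def by (metis diff_0_right dist_real_def half_gt_zero)
  show ?thesis
  \<comment> \<open>This threshold gives N - E > D / d, hence x / R < d, and also N - E >= 1, hence
    |w1| >= 1.\<close>
  proof (rule exI[of _ "E + D / d + 1"], intro allI impI)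
    fix N assume N: "E + D / d + 1 \<le> N"
    \<comment> \<open>Half of the limit value over the largest possible power of R, as R <= |w1| +
      |w2| + |w3| <= N + 3E.\<close>
    define C where "C = \<bar>f0\<bar> / 2 / (N + 3 * E) ^ (2 * m + 4)"
    have Dd: "D / d \<ge> 0" using D d(1) by simp
    have N1: "N - E \<ge> 1" using N Dd by linarith
    have "C > 0" unfolding C_def using f0 N1 E by (intro divide_pos_pos zero_less_power) auto
    moreover have "w1\<^sup>2 + w2\<^sup>2 + w3\<^sup>2 > 0 \<and>
        C \<le> - s * sgn f0 * (phi (2 * m) (w1\<^sup>2 + w2\<^sup>2 + w3\<^sup>2) x * w1)"
      if s: "s = 1 \<or> s = -1" and x: "0 \<le> x" "x \<le> D"
        and w: "\<bar>w1 + s * N\<bar> \<le> E" "\<bar>w2\<bar> \<le> E" "\<bar>w3\<bar> \<le> E" for s x w1 w2 w3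
    proof -
      define q where "q = - s * w1"
      define R where "R = sqrt (w1\<^sup>2 + w2\<^sup>2 + w3\<^sup>2)"
      have q: "N - E \<le> q" "q \<le> N + E" "\<bar>w1\<bar> = q" using s w(1) N1 by (auto simp: q_def)
      have "w1\<^sup>2 > 0" using q N1 by auto
      then have pos: "w1\<^sup>2 + w2\<^sup>2 + w3\<^sup>2 > 0" by (simp add: add_pos_nonneg)
      have R2: "R\<^sup>2 = w1\<^sup>2 + w2\<^sup>2 + w3\<^sup>2" using pos by (simp add: R_def)
      have Rq: "q \<le> R" unfolding q(3)[symmetric] R_def by (rule real_le_rsqrt) simp
      have R0: "R > 0" using Rq q N1 by linarith
      have "R \<le> \<bar>w1\<bar> + \<bar>w2\<bar> + \<bar>w3\<bar>" unfolding R_def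
        by (rule real_le_lsqrt) (simp_all add: power2_eq_square algebra_simps)
      then have RN: "R \<le> N + 3 * E" using q w by linarith
      have "D / d < R" using Rq q N Dd by linarith
      then have "D < R * d" using d(1) by (simp add: pos_divide_less_eq)
      then have "x / R < d" using x R0 by (simp add: pos_divide_less_eq mult.commute)
      then have near: "\<bar>phi (2 * m) 1 (x / R) - f0\<bar> < \<bar>f0\<bar> / 2" using d(2) x(1) R0 by simp
      have "phi (2 * m) (R\<^sup>2 * 1) (R * (x / R)) = phi (2 * m) 1 (x / R) / R ^ (2 * m + 4)"
        by (rule phi_scale[OF R0])
      then have e: "phi (2 * m) (w1\<^sup>2 + w2\<^sup>2 + w3\<^sup>2) x = phi (2 * m) 1 (x / R) / R ^ (2 * m + 4)"
        using R0 by (simp add: R2)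
      have big: "\<bar>f0\<bar> / 2 \<le> sgn f0 * phi (2 * m) 1 (x / R)"
        using near f0 by (simp add: sgn_if abs_if split: if_splits; linarith)
      have "C \<le> \<bar>f0\<bar> / 2 / R ^ (2 * m + 4)" unfolding C_def
        using R0 RN f0 by (intro divide_left_mono power_mono mult_pos_pos zero_less_power) auto
      also have "\<dots> \<le> sgn f0 * phi (2 * m) 1 (x / R) / R ^ (2 * m + 4)"
        using big R0 by (intro divide_right_mono) auto
      also have "\<dots> \<le> sgn f0 * phi (2 * m) 1 (x / R) / R ^ (2 * m + 4) * q"
      proof -
        have "0 \<le> sgn f0 * phi (2 * m) 1 (x / R) / R ^ (2 * m + 4)"
          using big R0 by (intro divide_nonneg_nonneg) auto
        moreover have "1 \<le> q" using q N1 by linarith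
        ultimately show ?thesis using mult_left_mono[of 1 q] by (metis mult.right_neutral)
      qed
      also have "\<dots> = - s * sgn f0 * (phi (2 * m) (w1\<^sup>2 + w2\<^sup>2 + w3\<^sup>2) x * w1)"
        unfolding e q_def by simp
      finally show ?thesis using pos by simp
    qed
    ultimately show "\<exists>C>0. \<forall>s x w1 w2 w3.
      (s = 1 \<or> s = -1) \<longrightarrow> 0 \<le> x \<longrightarrow> x \<le> D \<longrightarrow> \<bar>w1 + s * N\<bar> \<le> E \<longrightarrow> \<bar>w2\<bar> \<le> E \<longrightarrow> \<bar>w3\<bar> \<le> E \<longrightarrow>
      w1\<^sup>2 + w2\<^sup>2 + w3\<^sup>2 > 0 \<and>
      C \<le> - s * sgn (phi (2 * m) 1 0) * (phi (2 * m) (w1\<^sup>2 + w2\<^sup>2 + w3\<^sup>2) x * w1)"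
      unfolding f0_def[symmetric] by blast
  qed
qed

text \<open>Dilation scales the quaternion by l^2, so \<open>phi\<close> contributes (l^2)^(2(n - 1)
  + 4) = l^(4n + 4) to the denominator; the factor l^2 of the imaginary component leaves l^(4n +
  2).\<close>

lemma Kfun_dil_2:
  fixes u :: "'m::finite heis"
  assumes n: "n \<ge> 1" and l: "l > 0"
    and pos: "(fst u $ 1)\<^sup>2 + (fst u $ 2)\<^sup>2 + (fst u $ 3)\<^sup>2 > 0" (is "?r > 0")
  shows "Kfun n c (dil l u) $ 2 =
    - c * (phi (2 * (n - 1)) ?r ((norm (snd u))\<^sup>2) * fst u $ 1) / l ^ (4 * n + 2)"
proof -
  let ?k = "2 * (n - 1)"
  let ?x = "(norm (snd u))\<^sup>2"
  let ?p = "vector [(norm (l *\<^sub>R snd u))\<^sup>2, l\<^sup>2 * fst u $ 1, l\<^sup>2 * fst u $ 2, l\<^sup>2 * fst u $ 3] :: quat"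
  have nz: "dil l u \<noteq> (0, 0)"
    using l pos by (auto simp: dil_def)
  have "(l\<^sup>2)\<^sup>2 * ?r > 0" using pos l by simp
  moreover have "(?p $ 2)\<^sup>2 + (?p $ 3)\<^sup>2 + (?p $ 4)\<^sup>2 = (l\<^sup>2)\<^sup>2 * ?r"
    by (simp only: vector_4 power_mult_distrib distrib_left)
  ultimately have "szego n c ?p $ 2 = - c * phi ?k ((l\<^sup>2)\<^sup>2 * ?r) (?p $ 1) * ?p $ 2"
    by (rule szego_2)
  also have "?p $ 1 = l\<^sup>2 * ?x" using l by (simp add: power_mult_distrib)
  also have "phi ?k ((l\<^sup>2)\<^sup>2 * ?r) (l\<^sup>2 * ?x) = phi ?k ?r ?x / (l\<^sup>2) ^ (?k + 4)"
    using l by (intro phi_scale) simp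
  finally have "Kfun n c (dil l u) $ 2 = - c * (phi ?k ?r ?x / (l\<^sup>2) ^ (?k + 4)) * (l\<^sup>2 * fst u $ 1)"
    using nz by (simp add: Kfun_def) (simp add: dil_def)
  moreover have "(l\<^sup>2) ^ (?k + 4) = l ^ (4 * n + 2) * l\<^sup>2"
  proof -
    have "2 * (?k + 4) = (4 * n + 2) + 2" using n by simp
    then show ?thesis by (metis power_add power_mult)
  qed
  ultimately show ?thesis using l by simp
qed

section \<open>Choice of constants, the second tile and the sign of the kernel\<close>

theorem theorem1p3:
  fixes n :: nat and c :: real and n0 :: int
  assumes "n \<ge> 2" and "CARD('m::finite) = n - 1"
    and "c \<noteq> 0"
    and "n0 > 2 + \<lfloor>log 4 (Bmax TYPE('m))\<rfloor>"
  shows "\<exists>a0::nat. a0 > 0 \<and>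
    (\<forall>(j::int). \<forall>(T::'m heis set) \<in> tiles j. \<exists>!T'. T' \<in> tiles (j + int a0) \<and> T \<subseteq> T') \<and>
    (\<exists>(a1::real) (a2::real) (C::real). 3 \<le> a1 \<and> a1 \<le> a2 \<and> C > 0 \<and>
      (\<forall>(j::int). \<forall>(T::'m heis set) \<in> tiles j. \<exists>T1 \<in> tiles j.
         T1 \<subseteq> ancestor a0 j T \<and>
         a1 * 2 powi j \<le> hdist (cent n0 T) (cent n0 T1) \<and>
         hdist (cent n0 T) (cent n0 T1) \<le> a2 * 2 powi j \<and>
         (\<exists>i::4.
            (\<forall>g\<in>T. \<forall>g1\<in>T1. \<bar>Kker n c g g1 $ i\<bar> \<ge> C * 2 powi (- (4 * int n + 2) * j)) \<and>
            ((\<forall>g\<in>T. \<forall>g1\<in>T1. Kker n c g g1 $ i \<ge> 0) \<or>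
             (\<forall>g\<in>T. \<forall>g1\<in>T1. Kker n c g g1 $ i \<le> 0)))))"
proof -
  define D where "D = (4 * real CARD('m))\<^sup>2"
  define E where "E = 96 * real CARD('m) + 1"
  define G where "G = (\<lambda>x w1 w2 w3. phi (2 * (n - 1)) (w1\<^sup>2 + w2\<^sup>2 + w3\<^sup>2) x * w1)"
  define e where "e = sgn (phi (2 * (n - 1)) 1 0)"
  have e1: "\<bar>e\<bar> = 1" using phi_even_at_0 by (simp add: e_def abs_sgn_eq)
  have DE: "D \<ge> 0" "E \<ge> 0" by (simp_all add: D_def E_def)
  obtain N0 where N0: "\<And>N. N \<ge> N0 \<Longrightarrow> \<exists>C>0. \<forall>s x w1 w2 w3.
      (s = 1 \<or> s = -1) \<longrightarrow> 0 \<le> x \<longrightarrow> x \<le> D \<longrightarrow> \<bar>w1 + s * N\<bar> \<le> E \<longrightarrow> \<bar>w2\<bar> \<le> E \<longrightarrow> \<bar>w3\<bar> \<le> E \<longrightarrow>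
      w1\<^sup>2 + w2\<^sup>2 + w3\<^sup>2 > 0 \<and> C \<le> - s * e * G x w1 w2 w3"
    using phi_lower_bound[OF DE, where m = "n - 1"] unfolding G_def e_def by metis
  \<comment> \<open>\<open>N0\<close> serves the kernel estimate; 9 makes the distance
    \<open>root 4 (N\<^sup>2)\<close>, the square root of N, at least 3.\<close>
  obtain b :: nat where b: "max N0 9 < 4 ^ b" using real_arch_pow[of 4 "max N0 9"] by auto
  define a0 where "a0 = Suc b"
  define N :: real where "N = 4 ^ a0 / 2"
  \<comment> \<open>Taking \<open>a0 = Suc b\<close> makes N an integer, so the central shift maps
    the lattice to itself.\<close>
  have NI: "N = of_int (2 * 4 ^ b)" by (simp add: N_def a0_def)
  have "N \<ge> 4 ^ b" by (simp add: N_def a0_def)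
  then have N: "N \<ge> N0" "N \<ge> 9" using b by linarith+
  obtain C0 where C0: "C0 > 0" and bound: "\<And>s x w1 w2 w3.
      s = 1 \<or> s = -1 \<Longrightarrow> 0 \<le> x \<Longrightarrow> x \<le> D \<Longrightarrow> \<bar>w1 + s * N\<bar> \<le> E \<Longrightarrow> \<bar>w2\<bar> \<le> E \<Longrightarrow> \<bar>w3\<bar> \<le> E \<Longrightarrow>
      w1\<^sup>2 + w2\<^sup>2 + w3\<^sup>2 > 0 \<and> C0 \<le> - s * e * G x w1 w2 w3"
    using N0[OF N(1)] by blast
  have "root 4 81 \<le> root 4 (N\<^sup>2)"
    using power_mono[of 9 N 2] N(2) by (intro real_root_le_mono) auto
  moreover have "root 4 81 = (3 :: real)" using real_root_power_cancel[of 4 3] by simp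
  ultimately have N3: "3 \<le> root 4 (N\<^sup>2)" by simp
  have main: "\<exists>T1 \<in> tiles j.
         T1 \<subseteq> ancestor a0 j T \<and>
         root 4 (N\<^sup>2) * 2 powi j \<le> hdist (cent n0 T) (cent n0 T1) \<and>
         hdist (cent n0 T) (cent n0 T1) \<le> root 4 (N\<^sup>2) * 2 powi j \<and>
         (\<exists>i::4.
            (\<forall>g\<in>T. \<forall>g1\<in>T1. \<bar>Kker n c g g1 $ i\<bar> \<ge> (\<bar>c\<bar> * C0) * 2 powi (- (4 * int n + 2) * j)) \<and>
            ((\<forall>g\<in>T. \<forall>g1\<in>T1. Kker n c g g1 $ i \<ge> 0) \<or>
             (\<forall>g\<in>T. \<forall>g1\<in>T1. Kker n c g g1 $ i \<le> 0)))"
    if T: "T \<in> tiles j" for j and T :: "'m heis set"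
  proof -
    define l :: real where "l = 2 powi j"
    have l: "l > 0" by (simp add: l_def)
    obtain g where g: "g \<in> heisZ" "T = dil l ` ltrans g ` basic_tile"
      using T unfolding l_def by (rule tilesE)
    obtain p where p: "p \<in> T" using tile_nonempty[OF T] by blast
    obtain s where s: "s = 1 \<or> s = -1"
      and sp: "cshift (s * (2 powi (j + int a0))\<^sup>2 / 2) p \<in> ancestor a0 j T"
      using half_shift[OF ancestor_tile(1)[OF T, of a0], of p] ancestor_tile(2)[OF T, of a0] p by blast
    define h where "h = cshift (s * N) g"
    define T1 where "T1 = dil l ` ltrans h ` basic_tile"
    have h: "h \<in> heisZ"
      using g(1) s by (auto simp: h_def heisZ_def cshift_def NI axis_def)
    have T1: "T1 \<in> tiles j" unfolding T1_def l_def by (rule tilesI[OF h])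
    have "(2 powi (j + int a0) :: real)\<^sup>2 = l\<^sup>2 * 4 ^ a0"
      by (simp add: l_def power_int_add power_mult_distrib power_mult[symmetric] mult.commute[of a0])
         (simp add: power_mult)
    \<comment> \<open>Half the fibre of the ancestor, measured at the scale of \<open>T\<close>, is
      exactly N.\<close>
    then have sN: "s * (2 powi (j + int a0))\<^sup>2 / 2 = s * N * l\<^sup>2" by (simp add: N_def)
    obtain a where "a \<in> basic_tile" "p = dil l (ltrans g a)" using p g(2) by blast
    then have "cshift (s * N * l\<^sup>2) p \<in> T1"
      using l by (auto simp: T1_def h_def cshift_dil cshift_ltrans(2))
    then have "ancestor a0 j T1 = ancestor a0 j T"
      using ancestor_eqI[OF T1 ancestor_tile(1)[OF T]] sp sN by metis
    then have "T1 \<subseteq> ancestor a0 j T" using ancestor_tile(2)[OF T1] by metis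
    \<comment> \<open>The centres differ by the same central shift, so their distance is exact and
      one value can serve as both \<open>a1\<close> and \<open>a2\<close>.\<close>
    moreover have "hdist (cent n0 T) (cent n0 T1) = root 4 (N\<^sup>2) * 2 powi j"
      using l s hdist_cshift[of l g "base_point n0" "s * N"]
      unfolding g(2) T1_def l_def cent_tile[OF g(1)] cent_tile[OF h] by (auto simp: h_def)
    moreover have K: "\<exists>y. Kker n c x x1 $ 2 = c * e * s * y / l ^ (4 * n + 2) \<and> y \<ge> C0"
      if x: "x \<in> T" "x1 \<in> T1" for x x1
    proof -
      obtain a where a: "a \<in> basic_tile" "x = dil l (ltrans g a)" using x g(2) by blast
      obtain b where b: "b \<in> basic_tile" "x1 = dil l (ltrans h b)" using x T1_def by blast
      \<comment> \<open>Dilation and translation by \<open>g\<close> cancel in the group difference;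
        what remains is the difference of two points of the basic tile, shifted by -sN along the
        centre.\<close>
      define u where "u = hmult (hinv (cshift (s * N) b)) a"
      have Ku: "Kker n c x x1 = Kfun n c (dil l u)"
        by (simp add: Kker_def a b h_def hmult_hinv_dil hmult_hinv_ltrans u_def
            cshift_ltrans(2)[symmetric] cshift_ltrans(1))
      have u: "fst u = fst (hmult (hinv b) a) - (s * N) *\<^sub>R axis 1 1" "snd u = snd (hmult (hinv b) a)"
        by (simp_all add: u_def hmult_def hinv_def cshift_def)
      have "(norm (snd u))\<^sup>2 \<le> D"
        unfolding u D_def by (intro power_mono basic_tile_diff a b) simp
      moreover have "\<bar>fst u $ 1 + s * N\<bar> \<le> E" "\<bar>fst u $ 2\<bar> \<le> E" "\<bar>fst u $ 3\<bar> \<le> E"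
        using basic_tile_diff(2)[OF a(1) b(1)] by (simp_all add: u E_def axis_def)
      ultimately have r: "(fst u $ 1)\<^sup>2 + (fst u $ 2)\<^sup>2 + (fst u $ 3)\<^sup>2 > 0"
        and G: "C0 \<le> - s * e * G ((norm (snd u))\<^sup>2) (fst u $ 1) (fst u $ 2) (fst u $ 3)" (is "_ \<le> - s * e * ?G")
        using bound[OF s, of "(norm (snd u))\<^sup>2" "fst u $ 1" "fst u $ 2" "fst u $ 3"] by simp_all
      have "Kker n c x x1 $ 2 = - c * ?G / l ^ (4 * n + 2)"
        unfolding Ku G_def using assms(1) by (intro Kfun_dil_2 l r) simp
      \<comment> \<open>Inserting e^2 = s^2 = 1 separates the sign \<open>c * e * s\<close>, which
        is the same for all pairs of points, from a factor of size at least
        \<open>C0\<close>.\<close>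
      moreover have "c * e * s * (- s * e * z) = - c * ((e * e) * (s * s) * z)" for z
        by (simp add: mult_ac)
      moreover have "e * e = 1" "s * s = 1" using e1 s by (auto simp: abs_if split: if_splits)
      ultimately have "Kker n c x x1 $ 2 = c * e * s * (- s * e * ?G) / l ^ (4 * n + 2)"
        by simp
      with G show ?thesis by blast
    qed
    moreover have "\<bar>Kker n c x x1 $ 2\<bar> \<ge> (\<bar>c\<bar> * C0) * 2 powi (- (4 * int n + 2) * j)"
      if x: "x \<in> T" "x1 \<in> T1" for x x1
    proof -
      obtain y where y: "Kker n c x x1 $ 2 = c * e * s * y / l ^ (4 * n + 2)" "y \<ge> C0"
        using K[OF x] by blast
      have "l ^ (4 * n + 2) = 2 powi ((4 * int n + 2) * j)"
      proof -
        have "(4 * int n + 2) * j = j * int (4 * n + 2)" by simp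
        then show ?thesis unfolding l_def by (simp only: power_int_power')
      qed
      then have "2 powi (- (4 * int n + 2) * j) = 1 / l ^ (4 * n + 2)"
        by (metis inverse_eq_divide mult_minus_left power_int_minus)
      moreover have "\<bar>Kker n c x x1 $ 2\<bar> = \<bar>c\<bar> * y / l ^ (4 * n + 2)"
        using y C0 l e1 s by (auto simp: abs_mult)
      ultimately show ?thesis using y(2) l
        by (simp add: divide_right_mono mult_left_mono)
    qed
    moreover have "(\<forall>x\<in>T. \<forall>x1\<in>T1. Kker n c x x1 $ 2 \<ge> 0) \<or> (\<forall>x\<in>T. \<forall>x1\<in>T1. Kker n c x x1 $ 2 \<le> 0)"
    proof (cases "c * e * s \<ge> 0")
      case True
      have "Kker n c x x1 $ 2 \<ge> 0" if x: "x \<in> T" "x1 \<in> T1" for x x1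
        using K[OF x] True l C0 by auto
      then show ?thesis by blast
    next
      case False
      have "Kker n c x x1 $ 2 \<le> 0" if x: "x \<in> T" "x1 \<in> T1" for x x1
      proof -
        obtain y where y: "Kker n c x x1 $ 2 = c * e * s * y / l ^ (4 * n + 2)" "y \<ge> C0"
          using K[OF x] by blast
        have "c * e * s * y \<le> 0" using False y(2) C0 by (simp add: mult_nonpos_nonneg)
        then show ?thesis unfolding y(1) using l by (intro divide_nonpos_pos) simp_all
      qed
      then show ?thesis by blast
    qed
    ultimately show ?thesis
      by (intro bexI[OF _ T1] conjI exI[of _ "2 :: 4"]) simp_all
  qed
  show ?thesis
  proof (rule exI[of _ a0], intro conjI allI ballI)
    show "a0 > 0" by (simp add: a0_def)
  next
    fix j and T :: "'m heis set"
    assume "T \<in> tiles j"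
    then show "\<exists>!T'. T' \<in> tiles (j + int a0) \<and> T \<subseteq> T'" by (rule tile_ancestor)
  next
    have "\<bar>c\<bar> * C0 > 0" using C0 assms(3) by simp
    with N3 main show "\<exists>a1 a2 C. 3 \<le> a1 \<and> a1 \<le> a2 \<and> C > 0 \<and>
      (\<forall>j. \<forall>(T::'m heis set) \<in> tiles j. \<exists>T1 \<in> tiles j.
         T1 \<subseteq> ancestor a0 j T \<and>
         a1 * 2 powi j \<le> hdist (cent n0 T) (cent n0 T1) \<and>
         hdist (cent n0 T) (cent n0 T1) \<le> a2 * 2 powi j \<and>
         (\<exists>i::4.
            (\<forall>g\<in>T. \<forall>g1\<in>T1. \<bar>Kker n c g g1 $ i\<bar> \<ge> C * 2 powi (- (4 * int n + 2) * j)) \<and>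
            ((\<forall>g\<in>T. \<forall>g1\<in>T1. Kker n c g g1 $ i \<ge> 0) \<or>
             (\<forall>g\<in>T. \<forall>g1\<in>T1. Kker n c g g1 $ i \<le> 0))))"
      by (blast intro: order.refl)
  qed
qed

end
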